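(* Let $\mathcal{H}$ be a real Hilbert space, let $x\in\mathcal{H}$, and let $C$ be a nonempty, compact, and convex subset of $\mathcal{H}$ with diameter $\delta_C:=\sup_{(c_1,c_2)\in C^2}\|c_1-c_2\|\geq 0$ and bound $\mu_C:=\sup_{c\in C}\|c\|\geq 0$. Then, for every $\lambda>0$ and every $v\in\mathrm{LMO}_C(x)$, $$0\leq \langle \mathrm{Proj}_C(-\lambda x)\mid x\rangle-\min_{c\in C}\langle c\mid x\rangle\leq\frac{\|\mathrm{Proj}_C(-\lambda x)\|}{\lambda}\Big(\|v\|-\|\mathrm{Proj}_C(-\lambda x)\|\Big).$$ In consequence, $\|\mathrm{Proj}_C(-\lambda x)\|\leq\|v\|$ and, for every $\varepsilon>0$, $$\lambda\geq\frac{\min\{\delta_C\mu_C,\mu_C^2\}}{\varepsilon}\quad\Rightarrow\quad 0\leq \langle \mathrm{Proj}_C(-\lambda x)\mid x\rangle-\min_{c\in C}\langle c\mid x\rangle\leq\varepsilon.$$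
   Context: $\mathcal{H}$ has inner product $\langle\cdot\mid\cdot\rangle$ and induced norm $\|\cdot\|$. $\mathrm{Proj}_C\colon\mathcal{H}\to\mathcal{H}$ denotes the projection operator onto $C$, i.e., $\mathrm{Proj}_C(x)$ is the unique minimizer of $c\mapsto\|c-x\|$ over $C$. The set of linear minimization oracle points is $\mathrm{LMO}_C(x)=\operatorname{Argmin}_{c\in C}\langle c\mid x\rangle\subset C$, the set of all minimizers of $c\mapsto\langle c\mid x\rangle$ over $C$. *)

theory Defs
  imports "HOL-Analysis.Analysis"
begin

text \<open>The library's closest-point function requires a Heine-Borel type, hence finite dimension;
  the projection is therefore defined here for an arbitrary real inner product space. It is
  meaningful only if the minimizer exists and is unique, e.g. for nonempty, closed, convex sets
  in a Hilbert space.\<close>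

definition Proj :: "'a::real_inner set \<Rightarrow> 'a \<Rightarrow> 'a" where
  "Proj C x = (THE p. is_arg_min (\<lambda>c. norm (c - x)) (\<lambda>c. c \<in> C) p)"

definition LMO :: "'a::real_inner set \<Rightarrow> 'a \<Rightarrow> 'a set" where
  "LMO C x = {v. is_arg_min (\<lambda>c. c \<bullet> x) (\<lambda>c. c \<in> C) v}"

text \<open>The minimum of a function over a set, as opposed to its infimum: it is specified only when
  attained.\<close>

definition min_on :: "('a \<Rightarrow> real) \<Rightarrow> 'a set \<Rightarrow> real" where
  "min_on f C = (LEAST m. m \<in> f ` C)"

end

theory Submission
  imports Defs
begin

text \<open>Write \<open>p\<close> for the projection of \<open>- \<lambda> x\<close>. Testing the variational inequality
  \<open>\<langle>- \<lambda> x - p | c - p\<rangle> \<le> 0\<close> at \<open>c = v\<close> gives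
  \<open>\<lambda> \<langle>p - v | x\<rangle> \<le> \<langle>p | v\<rangle> - \<parallel>p\<parallel>\<^sup>2\<close>, and Cauchy-Schwarz finishes the first estimate. For the second,
  \<open>\<parallel>p\<parallel> \<le> \<mu>\<close>, while \<open>\<parallel>v\<parallel> - \<parallel>p\<parallel>\<close> is at most both \<open>\<parallel>v - p\<parallel> \<le> \<delta>\<close> and \<open>\<parallel>v\<parallel> \<le> \<mu>\<close>.\<close>

lemma min_on_eq:
  assumes "is_arg_min f (\<lambda>c. c \<in> C) v"
  shows "min_on f C = f v"
  unfolding min_on_def
  using assms by (intro Least_equality) (auto simp: is_arg_min_linorder)

lemma compact_is_arg_min:
  fixes f :: "'a::topological_space \<Rightarrow> real"
  assumes "compact C" "C \<noteq> {}" "continuous_on C f"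
  obtains v where "is_arg_min f (\<lambda>c. c \<in> C) v"
  using continuous_attains_inf[OF assms] by (auto simp: is_arg_min_linorder)

text \<open>Compactness yields a closest point and convexity makes it unique, so the definite
  description in \<open>Proj\<close> denotes it.\<close>

lemma is_arg_min_Proj:
  fixes z :: "'a::real_inner"
  assumes "compact C" "C \<noteq> {}" "convex C"
  shows "is_arg_min (\<lambda>c. norm (c - z)) (\<lambda>c. c \<in> C) (Proj C z)"
proof -
  let ?P = "is_arg_min (\<lambda>c. norm (c - z)) (\<lambda>c. c \<in> C)"
  have "p = q" if "?P p" "?P q" for p q
    using that any_closest_point_unique[OF assms(3) compact_imp_closed[OF assms(1)], of p q z]
    by (simp add: is_arg_min_linorder dist_norm norm_minus_commute)
  moreover have "continuous_on C (\<lambda>c. norm (c - z))"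
    by (intro continuous_intros)
  then obtain p where "?P p"
    by (rule compact_is_arg_min[OF assms(1,2)])
  ultimately show ?thesis
    unfolding Proj_def by (rule_tac theI)
qed

text \<open>If the inner product were positive, a short move from the projection towards
  \<open>c\<close>, which stays in \<open>C\<close> by convexity, would bring it closer to
  \<open>z\<close>.\<close>

lemma Proj_inner_le:
  fixes z :: "'a::real_inner"
  assumes "compact C" "convex C" "c \<in> C"
  shows "(z - Proj C z) \<bullet> (c - Proj C z) \<le> 0"
  using is_arg_min_Proj[OF assms(1) _ assms(2), of z] assms
  by (intro any_closest_point_dot[of C])
    (auto simp: compact_imp_closed is_arg_min_linorder dist_norm norm_minus_commute)

lemma Proj_LMO_bounds:
  fixes x :: "'a::real_inner"
  assumes "compact C" "convex C" "lam > 0" "v \<in> LMO C x"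
  defines "p \<equiv> Proj C (- (lam *\<^sub>R x))"
  shows "p \<in> C"
    and "0 \<le> p \<bullet> x - min_on (\<lambda>c. c \<bullet> x) C"
    and "p \<bullet> x - min_on (\<lambda>c. c \<bullet> x) C \<le> norm p / lam * (norm v - norm p)"
    and "norm p \<le> norm v"
proof -
  have v: "is_arg_min (\<lambda>c. c \<bullet> x) (\<lambda>c. c \<in> C) v"
    using assms(4) by (simp add: LMO_def)
  then have vC: "v \<in> C" and m: "min_on (\<lambda>c. c \<bullet> x) C = v \<bullet> x"
    by (auto simp: is_arg_min_def min_on_eq)
  then show "p \<in> C"
    unfolding p_def using is_arg_min_Proj[of C] assms(1,2) by (auto simp: is_arg_min_def)
  with v show nonneg: "0 \<le> p \<bullet> x - min_on (\<lambda>c. c \<bullet> x) C"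
    by (auto simp: m is_arg_min_linorder)
  have "lam * (p \<bullet> x - v \<bullet> x) \<le> p \<bullet> v - p \<bullet> p"
    using Proj_inner_le[OF assms(1,2) vC, of "- (lam *\<^sub>R x)", folded p_def]
    by (simp add: inner_diff_left inner_diff_right inner_commute algebra_simps)
  also have "\<dots> \<le> norm p * (norm v - norm p)"
    using norm_cauchy_schwarz[of p v]
    by (simp add: power2_norm_eq_inner[symmetric] power2_eq_square algebra_simps)
  \<comment> \<open>The factor \<open>lam\<close> stays on the left because the inequality serves
    twice: divided by \<open>lam\<close> it is the upper bound, and its nonnegative left side gives
    the comparison of norms.\<close>
  finally have gap: "lam * (p \<bullet> x - v \<bullet> x) \<le> norm p * (norm v - norm p)" .
  then show "p \<bullet> x - min_on (\<lambda>c. c \<bullet> x) C \<le> norm p / lam * (norm v - norm p)"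
    using assms(3) by (simp add: m field_simps)
  have "0 \<le> lam * (p \<bullet> x - v \<bullet> x)"
    using nonneg assms(3) by (simp add: m)
  with gap have "0 \<le> norm p * (norm v - norm p)"
    by linarith
  then show "norm p \<le> norm v"
    \<comment> \<open>For \<open>p = 0\<close> the product carries no information, but the claim is
      trivial; otherwise the positive factor \<open>norm p\<close> cancels.\<close>
    by (cases "p = 0") (simp_all add: zero_le_mult_iff)
qed

text \<open>Replaces the bound that depends on \<open>p\<close> and \<open>v\<close> by a constant
  of \<open>C\<close>; the minimum reflects two independent estimates of the second factor.\<close>

lemma norm_mult_diff_le:
  fixes C :: "'a::real_normed_vector set"
  assumes "bounded C" "p \<in> C" "v \<in> C"
  shows "norm p * (norm v - norm p)
    \<le> min (diameter C * (SUP c\<in>C. norm c)) ((SUP c\<in>C. norm c)\<^sup>2)"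
proof -
  let ?M = "SUP c\<in>C. norm c"
  have bdd: "bdd_above (norm ` C)"
    using assms(1) by (auto simp: bounded_iff intro: bdd_aboveI)
  have M: "norm p \<le> ?M" "norm v \<le> ?M"
    using assms(2,3) bdd by (auto intro: cSUP_upper)
  have D: "norm v - norm p \<le> diameter C"
    using diameter_bounded_bound[OF assms(1,3,2)] norm_triangle_ineq2[of v p]
    by (simp add: dist_norm)
  have M0: "0 \<le> ?M"
    using M(1) norm_ge_zero order_trans by blast
  \<comment> \<open>The difference of norms may be negative here, so it is enlarged first; the
    diameter is nonnegative, which then permits enlarging \<open>norm p\<close>.\<close>
  have "norm p * (norm v - norm p) \<le> norm p * diameter C"
    using D by (intro mult_left_mono) auto
  also have "\<dots> \<le> ?M * diameter C"
    using M(1) diameter_ge_0[OF assms(1)] by (intro mult_right_mono)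
  finally have "norm p * (norm v - norm p) \<le> diameter C * ?M"
    by (simp add: mult.commute)
  moreover have "norm p * (norm v - norm p) \<le> norm p * ?M"
    using M by (intro mult_left_mono) (auto intro: order_trans[of _ "norm v"])
  then have "norm p * (norm v - norm p) \<le> ?M\<^sup>2"
    using mult_right_mono[OF M(1) M0] by (simp add: power2_eq_square)
  ultimately show ?thesis
    by simp
qed

theorem theorem2:
  fixes x :: "'a::{real_inner, complete_space}" and C :: "'a set" and lam :: real
  assumes "C \<noteq> {}" and "compact C" and "convex C" and "lam > 0"
  shows "(\<forall>v \<in> LMO C x.
            0 \<le> Proj C (- (lam *\<^sub>R x)) \<bullet> x - min_on (\<lambda>c. c \<bullet> x) C \<and>
            Proj C (- (lam *\<^sub>R x)) \<bullet> x - min_on (\<lambda>c. c \<bullet> x) C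
              \<le> norm (Proj C (- (lam *\<^sub>R x))) / lam * (norm v - norm (Proj C (- (lam *\<^sub>R x)))) \<and>
            norm (Proj C (- (lam *\<^sub>R x))) \<le> norm v) \<and>
         (\<forall>\<epsilon>::real. \<epsilon> > 0 \<longrightarrow>
            lam \<ge> min (diameter C * (SUP c\<in>C. norm c)) ((SUP c\<in>C. norm c)\<^sup>2) / \<epsilon> \<longrightarrow>
            0 \<le> Proj C (- (lam *\<^sub>R x)) \<bullet> x - min_on (\<lambda>c. c \<bullet> x) C \<and>
            Proj C (- (lam *\<^sub>R x)) \<bullet> x - min_on (\<lambda>c. c \<bullet> x) C \<le> \<epsilon>)"
proof -
  let ?p = "Proj C (- (lam *\<^sub>R x))"
  let ?K = "min (diameter C * (SUP c\<in>C. norm c)) ((SUP c\<in>C. norm c)\<^sup>2)"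
  note bounds = Proj_LMO_bounds[OF assms(2-4)]
  have "continuous_on C (\<lambda>c. c \<bullet> x)"
    by (intro continuous_intros)
  \<comment> \<open>The \<epsilon>-estimate mentions no oracle point, so one is supplied by
    compactness.\<close>
  then obtain v where v: "v \<in> LMO C x"
    using compact_is_arg_min[OF assms(2,1)] unfolding LMO_def by blast
  have "?p \<bullet> x - min_on (\<lambda>c. c \<bullet> x) C \<le> \<epsilon>" if "\<epsilon> > 0" "lam \<ge> ?K / \<epsilon>" for \<epsilon>
  proof -
    have "v \<in> C"
      using v by (simp add: LMO_def is_arg_min_def)
    then have "norm ?p * (norm v - norm ?p) \<le> ?K"
      using bounds(1)[OF v] assms(2) by (intro norm_mult_diff_le compact_imp_bounded)
    also have "\<dots> \<le> lam * \<epsilon>"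
      using that by (simp add: pos_divide_le_eq)
    finally have "norm ?p / lam * (norm v - norm ?p) \<le> \<epsilon>"
      using assms(4) by (simp add: field_simps)
    with bounds(3)[OF v] show ?thesis
      by (rule order_trans)
  qed
  with bounds(2)[OF v] bounds show ?thesis
    by blast
qed

end
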